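(* Let $n,d\in\mathbb{N}$ with $n\ge 2$ and let $\kappa\in\mathbb{N}^n$ be such that $\kappa_1=\kappa_2=d$. Define a linear operator $T_d:\mathbb{C}_\kappa[z_1,\ldots,z_n]\to\mathbb{C}_\kappa[z_1,\ldots,z_n]$ by $$T_d(f)=\frac{1}{d!}\sum_{k=0}^d\frac{\partial^d f}{\partial z_1^k\,\partial z_2^{d-k}}.$$ Then $T_d$ preserves $\mathbb{H}_\theta$-stability for any $0\le\theta<2\pi$.
   Context: $\mathbb{C}_\kappa[z_1,\ldots,z_n]$ is the space of complex polynomials $f$ with $\deg_{z_i}(f)\le\kappa_i$ for all $i$. $\mathbb{H}_\theta=\{z\in\mathbb{C}:\mathrm{Im}(e^{i\theta}z)>0\}$. A polynomial is $\mathbb{H}_\theta$-stable if it is nonzero whenever all its variables lie in $\mathbb{H}_\theta$. A linear operator preserves $\mathbb{H}_\theta$-stability if it maps each $\mathbb{H}_\theta$-stable polynomial in its domain to an $\mathbb{H}_\theta$-stable polynomial or to $0$. *)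

theory Defs
  imports "HOL-Analysis.Analysis" "HOL-Library.Poly_Mapping"
begin

text \<open>
  A monomial is a finitely supported exponent function, and a polynomial is a finitely
  supported coefficient function on monomials. The variables are \<open>z\<^sub>1, \<dots>, z\<^sub>n\<close>, so that only
  the indices in \<open>{1..n}\<close> matter.
\<close>

type_synonym cmpoly = "(nat \<Rightarrow>\<^sub>0 nat) \<Rightarrow>\<^sub>0 complex"

definition mp_eval :: "(nat \<Rightarrow> complex) \<Rightarrow> cmpoly \<Rightarrow> complex" where
  "mp_eval z f = (\<Sum>m\<in>Poly_Mapping.keys f. Poly_Mapping.lookup f m *
     (\<Prod>i\<in>Poly_Mapping.keys m. z i ^ Poly_Mapping.lookup m i))"

definition mp_scale :: "complex \<Rightarrow> cmpoly \<Rightarrow> cmpoly" where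
  "mp_scale c f = Poly_Mapping.map ((*) c) f"

text \<open>
  Truncated subtraction of exponents is harmless in the following definition: a monomial
  that does not contain \<open>z\<^sub>i\<close> gets the coefficient \<open>0\<close>.
\<close>

definition mp_deriv :: "nat \<Rightarrow> cmpoly \<Rightarrow> cmpoly" where
  "mp_deriv i f = (\<Sum>m\<in>Poly_Mapping.keys f. Poly_Mapping.single (m - Poly_Mapping.single i 1)
     (of_nat (Poly_Mapping.lookup m i) * Poly_Mapping.lookup f m))"

definition deg_in :: "nat \<Rightarrow> cmpoly \<Rightarrow> nat" where
  "deg_in i f = Max (insert 0 ((\<lambda>m. Poly_Mapping.lookup m i) ` Poly_Mapping.keys f))"

definition poly_space :: "nat \<Rightarrow> (nat \<Rightarrow> nat) \<Rightarrow> cmpoly set" where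
  "poly_space n \<kappa> = {f. (\<forall>m\<in>Poly_Mapping.keys f. Poly_Mapping.keys m \<subseteq> {1..n}) \<and>
                        (\<forall>i\<in>{1..n}. deg_in i f \<le> \<kappa> i)}"

definition half_plane :: "real \<Rightarrow> complex set" where
  "half_plane \<theta> = {z. Im (exp (\<i> * of_real \<theta>) * z) > 0}"

definition stable :: "nat \<Rightarrow> real \<Rightarrow> cmpoly \<Rightarrow> bool" where
  "stable n \<theta> f \<longleftrightarrow> (\<forall>z. (\<forall>i\<in>{1..n}. z i \<in> half_plane \<theta>) \<longrightarrow> mp_eval z f \<noteq> 0)"

definition preserves_stability ::
    "nat \<Rightarrow> real \<Rightarrow> cmpoly set \<Rightarrow> (cmpoly \<Rightarrow> cmpoly) \<Rightarrow> bool" where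
  "preserves_stability n \<theta> V T \<longleftrightarrow> (\<forall>f\<in>V. stable n \<theta> f \<longrightarrow> stable n \<theta> (T f) \<or> T f = 0)"

text \<open>
  The operator is given by its formula on all polynomials; it is meant to be restricted to
  \<open>poly_space n \<kappa>\<close>, which it maps into itself (lemma \<open>T_op_in_poly_space\<close>).
\<close>

definition T_op :: "nat \<Rightarrow> cmpoly \<Rightarrow> cmpoly" where
  "T_op d f = mp_scale (1 / fact d) (\<Sum>k=0..d. (mp_deriv 1 ^^ k) ((mp_deriv 2 ^^ (d - k)) f))"

lemma lookup_mp_scale [simp]:
  "Poly_Mapping.lookup (mp_scale c f) m = c * Poly_Mapping.lookup f m"
  by (simp add: mp_scale_def Poly_Mapping.map.rep_eq "when_def")

lemma lookup_mp_deriv: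
  "Poly_Mapping.lookup (mp_deriv i f) m =
     of_nat (Suc (Poly_Mapping.lookup m i)) * Poly_Mapping.lookup f (m + Poly_Mapping.single i 1)"
proof -
  let ?l = "Poly_Mapping.lookup" and ?e = "Poly_Mapping.single i (1::nat)"
  have eq: "?l (Poly_Mapping.single (m' - ?e) (of_nat (?l m' i) * ?l f m')) m =
      (if m' = m + ?e then of_nat (Suc (?l m i)) * ?l f (m + ?e) else 0)" for m'
  proof (cases "?l m' i = 0")
    case True
    then have "m' \<noteq> m + ?e" by (auto simp: lookup_add)
    with True show ?thesis by simp
  next
    case False
    have "m' - ?e = m \<longleftrightarrow> m' = m + ?e"
    proof
      assume "m' - ?e = m"
      then show "m' = m + ?e"
        using False by (auto intro!: poly_mapping_eqI simp: lookup_add lookup_minus lookup_single "when_def")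
    qed simp
    then show ?thesis by (auto simp: lookup_single "when_def" lookup_add)
  qed
  show ?thesis
    unfolding mp_deriv_def lookup_sum eq
    by (auto simp: in_keys_iff)
qed

lemma deg_in_le_iff: "deg_in i f \<le> N \<longleftrightarrow> (\<forall>m\<in>Poly_Mapping.keys f. Poly_Mapping.lookup m i \<le> N)"
  unfolding deg_in_def by (subst Max_le_iff) auto

lemma mp_eval_superset:
  assumes "finite A" "Poly_Mapping.keys f \<subseteq> A"
  shows "mp_eval z f = (\<Sum>m\<in>A. Poly_Mapping.lookup f m *
     (\<Prod>i\<in>Poly_Mapping.keys m. z i ^ Poly_Mapping.lookup m i))"
  unfolding mp_eval_def using assms by (intro sum.mono_neutral_left) (auto simp: in_keys_iff)

lemma mp_eval_0 [simp]: "mp_eval z 0 = 0"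
  by (simp add: mp_eval_def)

lemma mp_eval_add: "mp_eval z (f + g) = mp_eval z f + mp_eval z g"
proof -
  let ?A = "Poly_Mapping.keys f \<union> Poly_Mapping.keys g"
  have "Poly_Mapping.keys (f + g) \<subseteq> ?A" by (rule Poly_Mapping.keys_add)
  then show ?thesis
    by (simp add: mp_eval_superset[of ?A] lookup_add sum.distrib algebra_simps)
qed

lemma mp_eval_sum: "mp_eval z (\<Sum>x\<in>X. g x) = (\<Sum>x\<in>X. mp_eval z (g x))"
  by (induction X rule: infinite_finite_induct) (simp_all add: mp_eval_add)

lemma mp_eval_single:
  "mp_eval z (Poly_Mapping.single m c) =
     c * (\<Prod>i\<in>Poly_Mapping.keys m. z i ^ Poly_Mapping.lookup m i)"
  by (subst mp_eval_superset[of "{m}"]) auto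

lemma mp_eval_deriv:
  "((\<lambda>t. mp_eval (z(i := t)) f) has_field_derivative mp_eval (z(i := t)) (mp_deriv i f)) (at t)"
proof -
  let ?l = "Poly_Mapping.lookup" and ?e = "Poly_Mapping.single i (1::nat)"
  let ?M = "\<lambda>t m. \<Prod>j\<in>Poly_Mapping.keys m. (z(i := t)) j ^ ?l m j"
  let ?R = "\<lambda>m. \<Prod>j\<in>Poly_Mapping.keys m - {i}. z j ^ ?l m j"
  have split: "?M t m = t ^ ?l m i * ?R m" for t m
  proof -
    have "?M t m = (\<Prod>j\<in>insert i (Poly_Mapping.keys m). (z(i := t)) j ^ ?l m j)"
      by (rule prod.mono_neutral_left) (auto simp: in_keys_iff)
    also have "\<dots> = t ^ ?l m i * (\<Prod>j\<in>Poly_Mapping.keys m - {i}. (z(i := t)) j ^ ?l m j)"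
      by (subst prod.insert_remove) auto
    also have "(\<Prod>j\<in>Poly_Mapping.keys m - {i}. (z(i := t)) j ^ ?l m j) = ?R m"
      by (rule prod.cong) auto
    finally show ?thesis .
  qed
  have R: "?R (m - ?e) = ?R m" for m
    by (rule prod.cong) (auto simp: in_keys_iff lookup_minus lookup_single "when_def")
  have "((\<lambda>t. \<Sum>m\<in>Poly_Mapping.keys f. ?l f m * (t ^ ?l m i * ?R m)) has_field_derivative
      (\<Sum>m\<in>Poly_Mapping.keys f. ?l f m * (of_nat (?l m i) * t ^ (?l m i - 1) * ?R m))) (at t)"
    by (auto intro!: derivative_eq_intros simp: mult_ac)
  moreover have "mp_eval (z(i := t)) (mp_deriv i f) =
      (\<Sum>m\<in>Poly_Mapping.keys f. ?l f m * (of_nat (?l m i) * t ^ (?l m i - 1) * ?R m))"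
    unfolding mp_deriv_def mp_eval_sum mp_eval_single split R
    by (intro sum.cong) (auto simp: lookup_minus)
  ultimately show ?thesis unfolding mp_eval_def[of _ f] split by simp
qed

lemma vector_space_mp_scale: "vector_space mp_scale"
  by unfold_locales (auto intro!: poly_mapping_eqI simp: lookup_add algebra_simps)

lemma linear_mp_deriv: "Vector_Spaces.linear mp_scale mp_scale (mp_deriv i)"
proof -
  interpret vector_space mp_scale by (rule vector_space_mp_scale)
  show ?thesis
    by unfold_locales (auto intro!: poly_mapping_eqI simp: lookup_add lookup_mp_deriv algebra_simps)
qed

lemma linear_T_op: "Vector_Spaces.linear mp_scale mp_scale (T_op d)"
proof -
  interpret vector_space mp_scale by (rule vector_space_mp_scale)
  interpret D: Vector_Spaces.linear mp_scale mp_scale "mp_deriv i" for i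
    by (rule linear_mp_deriv)
  have add: "(mp_deriv i ^^ k) (f + g) = (mp_deriv i ^^ k) f + (mp_deriv i ^^ k) g" for i k f g
    by (induction k) (simp_all add: D.add)
  have scale: "(mp_deriv i ^^ k) (mp_scale c f) = mp_scale c ((mp_deriv i ^^ k) f)" for i k c f
    by (induction k) (simp_all add: D.scale)
  have "T_op d (f + g) = T_op d f + T_op d g" for f g
    by (simp only: T_op_def add sum.distrib scale_right_distrib)
  moreover have "T_op d (mp_scale c f) = mp_scale c (T_op d f)" for c f
    unfolding T_op_def scale scale_sum_right[symmetric] by (rule scale_left_commute)
  ultimately show ?thesis by unfold_locales
qed

lemma mp_deriv_in_poly_space:
  assumes "f \<in> poly_space n \<kappa>"
  shows "mp_deriv i f \<in> poly_space n \<kappa>"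
proof -
  have "Poly_Mapping.keys m \<subseteq> {1..n} \<and> (\<forall>j\<in>{1..n}. Poly_Mapping.lookup m j \<le> \<kappa> j)"
    if "m \<in> Poly_Mapping.keys (mp_deriv i f)" for m
  proof -
    let ?m = "m + Poly_Mapping.single i (1::nat)"
    have "?m \<in> Poly_Mapping.keys f"
      using that by (auto simp: in_keys_iff lookup_mp_deriv)
    then have *: "Poly_Mapping.keys ?m \<subseteq> {1..n}" "\<forall>j\<in>{1..n}. Poly_Mapping.lookup ?m j \<le> \<kappa> j"
      using assms by (auto simp: poly_space_def deg_in_le_iff)
    have "Poly_Mapping.keys m \<subseteq> Poly_Mapping.keys ?m"
      by (auto simp: in_keys_iff lookup_add)
    moreover have "Poly_Mapping.lookup m j \<le> Poly_Mapping.lookup ?m j" for j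
      by (simp add: lookup_add)
    ultimately show ?thesis using * by (meson order_trans)
  qed
  then show ?thesis by (auto simp: poly_space_def deg_in_le_iff)
qed

lemma T_op_in_poly_space:
  assumes "f \<in> poly_space n \<kappa>"
  shows "T_op d f \<in> poly_space n \<kappa>"
proof -
  have "(mp_deriv i ^^ k) g \<in> poly_space n \<kappa>" if "g \<in> poly_space n \<kappa>" for i k g
    using that by (induction k) (simp_all add: mp_deriv_in_poly_space)
  then have *: "(mp_deriv 1 ^^ k) ((mp_deriv 2 ^^ (d - k)) f) \<in> poly_space n \<kappa>" for k
    using assms by blast
  have keys: "\<exists>k. m \<in> Poly_Mapping.keys ((mp_deriv 1 ^^ k) ((mp_deriv 2 ^^ (d - k)) f))"
    if "m \<in> Poly_Mapping.keys (T_op d f)" for m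
    using that unfolding in_keys_iff T_op_def
    by (auto simp: lookup_sum elim: sum.not_neutral_contains_not_neutral)
  show ?thesis
    using * keys unfolding poly_space_def deg_in_le_iff by blast
qed

end

theory Submission
  imports Defs "HOL-Complex_Analysis.Great_Picard"
begin

text \<open>
  Fix a point \<open>z\<close> with all coordinates in the half-plane and expand \<open>f\<close> around it in the first two
  variables, with Taylor coefficients \<open>b\<^sub>i\<^sub>j\<close> for \<open>i, j \<le> d\<close>. Up to a factor \<open>1 / d!\<close>, the value of
  \<open>T_op d f\<close> at \<open>z\<close> is \<open>\<Sum>\<^sub>k k! (d - k)! b\<^sub>k\<^sub>,\<^sub>d\<^sub>-\<^sub>k\<close>. This is the apolar pairing of Grace's theorem (up to
  sign conventions), extended from products of two univariate polynomials to polynomials in two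
  variables. After polarization of the Taylor polynomial to a multiaffine polynomial in
  \<open>x\<^sub>1, \<dots>, x\<^sub>d, y\<^sub>1, \<dots>, y\<^sub>d\<close>, the operator becomes \<open>\<Prod>\<^sub>l (\<partial>/\<partial>x\<^sub>l + \<partial>/\<partial>y\<^sub>l)\<close>, evaluated at the
  origin, and each factor maps a stable polynomial to a stable one or to \<open>0\<close>.

  The polarization is carried out one pair of variables at a time. By Laguerre's theorem
  (\<open>Laguerre_polar_derivative\<close>) the polar derivative splits off one affine variable and lowers the
  degree, without creating zeros in the half-plane. After doing so in both variables, applying
  \<open>\<partial>\<^sub>\<zeta> + \<partial>\<^sub>\<eta>\<close> to the two new variables and evaluating leaves a polynomial of degree at most
  \<open>d - 1\<close> in each variable, to which the argument applies again.

  The derivative of a stable polynomial may vanish identically, and then the second alternative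
  of the theorem occurs. To avoid this distinction in the induction, \<open>\<partial>\<^sub>\<zeta> + \<partial>\<^sub>\<eta>\<close> is
  perturbed to \<open>\<partial>\<^sub>\<zeta> + \<partial>\<^sub>\<eta> + \<gamma>\<close> with \<open>Im \<gamma> < 0\<close>, which never gives zero
  (\<open>biaffine_nonvanishing\<close>, \<open>apolar_weight_nonvanishing\<close>). The limit \<open>\<gamma> \<rightarrow> 0\<close> is taken at the very end
  with Hurwitz's theorem on complex lines: if \<open>T_op d f\<close> has a zero with all variables in the half-plane,
  then it vanishes at all such points (\<open>T_op_zero_everywhere\<close>), and hence as a polynomial
  (\<open>vanishing_imp_zero\<close>).
\<close>

section \<open>Laguerre's theorem on polar derivatives\<close>

text \<open>
  Inversion maps the half-plane \<open>Im s \<ge> h\<close> onto a closed disc without the origin, which is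
  a point of its boundary. Both facts are exploited below: the disc is convex, so averages of such
  inverses stay in it, and missing terms of an average may be replaced by \<open>0\<close>.
\<close>

lemma inverse_in_disc_iff:
  assumes h: "h > 0" and s: "s \<noteq> 0"
  shows "norm (1 / s + \<i> * of_real (1 / (2 * h))) \<le> 1 / (2 * h) \<longleftrightarrow> h \<le> Im s"
proof -
  have eq: "1 / s + \<i> * of_real (1 / (2 * h)) = (of_real (2 * h) + \<i> * s) / (s * of_real (2 * h))"
    using h s by (simp add: field_simps)
  have "norm (1 / s + \<i> * of_real (1 / (2 * h))) \<le> 1 / (2 * h) \<longleftrightarrow>
      norm (of_real (2 * h) + \<i> * s) \<le> norm s"
    unfolding eq norm_divide norm_mult norm_of_real using h s by (simp add: field_simps)
  also have "\<dots> \<longleftrightarrow> (norm (of_real (2 * h) + \<i> * s))\<^sup>2 \<le> (norm s)\<^sup>2"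
    by (simp add: power2_le_iff_abs_le)
  also have "\<dots> \<longleftrightarrow> 4 * h * h \<le> 4 * h * Im s"
    unfolding cmod_power2 by (simp add: power2_eq_square algebra_simps)
  also have "\<dots> \<longleftrightarrow> h \<le> Im s"
    using h by simp
  finally show ?thesis .
qed

text \<open>
  The logarithmic derivative \<open>w\<close> at \<open>u\<close> is the sum of the numbers \<open>1 / (u - r)\<close> over the roots
  \<open>r\<close>, which lie in \<open>Im r \<le> a\<close>. Each of them belongs to the disc of the preceding lemma with
  \<open>h = Im u - a\<close>, so that the triangle inequality puts the sum into the disc scaled by the number
  of roots. The origin belongs to the disc, which is why an upper bound \<open>M\<close> for the degree may take
  the place of the degree itself.
\<close>

lemma log_derivative_in_disc:
  fixes p :: "complex poly"
  assumes "degree p \<le> M" and "\<And>x. Im x > a \<Longrightarrow> poly p x \<noteq> 0" and u: "Im u > a"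
  shows "\<exists>w. poly (pderiv p) u = w * poly p u \<and>
    norm (w + of_nat M * (\<i> * of_real (1 / (2 * (Im u - a))))) \<le> M * (1 / (2 * (Im u - a)))"
  using assms(1,2)
proof (induction M arbitrary: p)
  case 0
  then have "pderiv p = 0" by (simp add: pderiv_eq_0_iff)
  then show ?case by (intro exI[of _ 0]) simp
next
  case (Suc M)
  let ?h = "Im u - a"
  let ?c = "\<i> * complex_of_real (1 / (2 * ?h))"
  have h: "?h > 0" using u by simp
  have nc: "norm ?c = 1 / (2 * ?h)" unfolding norm_mult norm_of_real using h by simp
  show ?case
  proof (cases "degree p = 0")
    case True
    then have "pderiv p = 0" by (simp add: pderiv_eq_0_iff)
    moreover have "norm (of_nat (Suc M) * ?c) = Suc M * (1 / (2 * ?h))"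
      by (simp only: norm_mult[of "of_nat (Suc M)"] norm_of_nat nc)
    ultimately show ?thesis by (intro exI[of _ 0]) simp
  next
    case False
    then have "coeff p (degree p) \<noteq> 0" "degree p \<in> {1..degree p}" by auto
    then obtain r where "(\<Sum>i\<le>degree p. coeff p i * r ^ i) = 0"
      using fundamental_theorem_of_algebra[of "coeff p" "degree p"] by blast
    then have "poly p r = 0" by (simp add: poly_altdef)
    from this obtain q where p: "p = [:-r, 1:] * q" by (auto simp: poly_eq_0_iff_dvd)
    have "q \<noteq> 0" using False p by auto
    then have "degree p = Suc (degree q)" unfolding p by (subst degree_mult_eq) auto
    then have "degree q \<le> M" using Suc.prems(1) by simp
    moreover have "poly q x \<noteq> 0" if "Im x > a" for x
      using Suc.prems(2)[OF that] by (simp add: p)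
    ultimately obtain w where w: "poly (pderiv q) u = w * poly q u"
        "norm (w + of_nat M * ?c) \<le> M * (1 / (2 * ?h))"
      using Suc.IH[of q] by blast
    have "Im r \<le> a" using Suc.prems(2)[of r] \<open>poly p r = 0\<close> by force
    then have s: "u - r \<noteq> 0" "?h \<le> Im (u - r)" using u by auto
    have "pderiv p = [:-r, 1:] * pderiv q + q"
      by (simp only: p pderiv_mult) (simp add: pderiv_pCons)
    then have "poly (pderiv p) u = (u - r) * (w * poly q u) + poly q u"
      by (simp only: poly_add poly_mult w) (simp add: algebra_simps)
    also have "\<dots> = (1 / (u - r) + w) * poly p u"
      using s(1) by (simp add: p field_simps)
    finally have "poly (pderiv p) u = (1 / (u - r) + w) * poly p u" .
    moreover have "norm ((1 / (u - r) + w) + of_nat (Suc M) * ?c) \<le> Suc M * (1 / (2 * ?h))"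
    proof -
      have "(1 / (u - r) + w) + of_nat (Suc M) * ?c = (1 / (u - r) + ?c) + (w + of_nat M * ?c)"
        by (simp only: of_nat_Suc distrib_right mult_1 add_ac)
      also have "norm \<dots> \<le> norm (1 / (u - r) + ?c) + norm (w + of_nat M * ?c)"
        by (rule norm_triangle_ineq)
      also have "\<dots> \<le> 1 / (2 * ?h) + M * (1 / (2 * ?h))"
        using inverse_in_disc_iff[OF h s(1)] s(2) w(2) by (intro add_mono) auto
      also have "\<dots> = Suc M * (1 / (2 * ?h))"
        by (simp only: of_nat_Suc distrib_right mult_1)
      finally show ?thesis .
    qed
    ultimately show ?thesis by blast
  qed
qed

text \<open>
  For \<open>p(x) = (\<Sum>i\<le>M. c i * x ^ i)\<close> the sum in the conclusion is the polar derivative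
  \<open>M * p(u) + (\<zeta> - u) * p'(u)\<close>. If it vanished, the logarithmic derivative of \<open>p\<close> at \<open>u\<close> would be
  \<open>M / (u - \<zeta>)\<close>, and the preceding lemma, read backwards through the inversion, would
  push \<open>\<zeta>\<close> out of the half-plane. The coefficient form shows that the polar derivative has degree
  less than \<open>M\<close> in \<open>u\<close> and degree at most \<open>1\<close> in \<open>\<zeta>\<close>: one variable has been split off.
\<close>

lemma Laguerre_polar_derivative:
  fixes c :: "nat \<Rightarrow> complex"
  assumes M: "M > 0" and nz: "\<And>x. Im x > a \<Longrightarrow> (\<Sum>i\<le>M. c i * x ^ i) \<noteq> 0"
    and u: "Im u > a" and \<zeta>: "Im \<zeta> > a"
  shows "(\<Sum>i\<le>M. c i * (of_nat (M - i) * u ^ i + \<zeta> * (of_nat i * u ^ (i - 1)))) \<noteq> 0"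
proof
  assume zero: "(\<Sum>i\<le>M. c i * (of_nat (M - i) * u ^ i + \<zeta> * (of_nat i * u ^ (i - 1)))) = 0"
  define p where "p = (\<Sum>i\<le>M. monom (c i) i)"
  have p: "poly p x = (\<Sum>i\<le>M. c i * x ^ i)" for x
    by (simp add: p_def poly_sum poly_monom)
  have p': "poly (pderiv p) x = (\<Sum>i\<le>M. c i * (of_nat i * x ^ (i - 1)))" for x
    unfolding p_def higher_pderiv_sum[of 1, simplified] poly_sum
    by (simp add: pderiv_monom poly_monom mult_ac)
  have "degree p \<le> M"
    unfolding p_def by (intro degree_sum_le) (auto intro: order.trans[OF degree_monom_le])
  then obtain w where w: "poly (pderiv p) u = w * poly p u"
      "norm (w + of_nat M * (\<i> * of_real (1 / (2 * (Im u - a))))) \<le> M * (1 / (2 * (Im u - a)))"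
    using log_derivative_in_disc[of p M a u] nz u by (auto simp: p)
  have summand: "c i * (of_nat (M - i) * u ^ i + \<zeta> * (of_nat i * u ^ (i - 1))) =
      of_nat M * (c i * u ^ i) + (\<zeta> - u) * (c i * (of_nat i * u ^ (i - 1)))" if "i \<le> M" for i
    using that by (cases i) (simp_all add: of_nat_diff algebra_simps)
  have "of_nat M * poly p u + (\<zeta> - u) * poly (pderiv p) u =
      (\<Sum>i\<le>M. of_nat M * (c i * u ^ i) + (\<zeta> - u) * (c i * (of_nat i * u ^ (i - 1))))"
    by (simp only: p p' sum.distrib sum_distrib_left)
  also have "\<dots> = 0"
    unfolding zero[symmetric] by (intro sum.cong refl) (simp only: summand atMost_iff)
  finally have "(of_nat M + (\<zeta> - u) * w) * poly p u = 0"
    by (simp add: w(1) algebra_simps)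
  then have "of_nat M + (\<zeta> - u) * w = 0"
    using nz[OF u] unfolding p mult_eq_0_iff by blast
  then have "of_nat M = (u - \<zeta>) * w"
    by algebra
  moreover from this have s: "u - \<zeta> \<noteq> 0" using M by auto
  ultimately have wM: "w = of_nat M * (1 / (u - \<zeta>))" by (simp add: field_simps)
  have "norm (w + of_nat M * (\<i> * of_real (1 / (2 * (Im u - a))))) =
      M * norm (1 / (u - \<zeta>) + \<i> * of_real (1 / (2 * (Im u - a))))"
    unfolding wM distrib_left[symmetric] norm_mult by simp
  with w(2) M have "norm (1 / (u - \<zeta>) + \<i> * of_real (1 / (2 * (Im u - a)))) \<le> 1 / (2 * (Im u - a))"
    by (metis mult_le_cancel_left_pos of_nat_0_less_iff)
  moreover have "Im u - a > 0" using u by simp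
  ultimately have "Im u - a \<le> Im (u - \<zeta>)" using inverse_in_disc_iff[OF _ s] by blast
  with \<zeta> show False by simp
qed

section \<open>Apolar pairing of two variables\<close>

text \<open>
  The expression is the derivative \<open>\<partial>\<^sub>\<zeta> + \<partial>\<^sub>\<eta> + \<gamma>\<close> of the biaffine polynomial, taken at the origin.
  Since \<open>A + B * \<zeta>\<close> has no root in the closed upper half-plane, \<open>B / A\<close> has nonpositive imaginary
  part; so has \<open>C / A\<close>, and adding \<open>\<gamma>\<close> makes the imaginary part of the sum negative. Without \<open>\<gamma>\<close>
  the value could be \<open>0\<close>, namely for \<open>B = C = 0\<close>.
\<close>

lemma biaffine_nonvanishing:
  fixes A B C D \<gamma> :: complex
  assumes nz: "\<And>\<zeta> \<eta>. Im \<zeta> \<ge> 0 \<Longrightarrow> Im \<eta> \<ge> 0 \<Longrightarrow> A + B * \<zeta> + C * \<eta> + D * \<zeta> * \<eta> \<noteq> 0"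
    and \<gamma>: "Im \<gamma> < 0"
  shows "B + C + \<gamma> * A \<noteq> 0"
proof -
  have A: "A \<noteq> 0" using nz[of 0 0] by simp
  have neg: "Im (E / A) \<le> 0" if E: "\<And>\<zeta>. Im \<zeta> \<ge> 0 \<Longrightarrow> A + E * \<zeta> \<noteq> 0" for E
  proof (rule ccontr)
    assume *: "\<not> Im (E / A) \<le> 0"
    then have "E \<noteq> 0" by auto
    have "Im (- (1 / (E / A))) = Im (E / A) / (norm (E / A))\<^sup>2"
      by (simp add: Im_divide cmod_power2 del: divide_divide_eq_right)
    also have "\<dots> \<ge> 0" using * by (intro divide_nonneg_nonneg) auto
    finally show False using E[of "- (1 / (E / A))"] \<open>E \<noteq> 0\<close> A by simp
  qed
  have "Im (B / A) \<le> 0" using nz[of _ 0] by (intro neg) simp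
  moreover have "Im (C / A) \<le> 0" using nz[of 0] by (intro neg) simp
  ultimately have "Im (B / A + C / A + \<gamma>) < 0" using \<gamma> by simp
  then have "B / A + C / A + \<gamma> \<noteq> 0" by (metis less_irrefl zero_complex.sel(2))
  moreover have "B + C + \<gamma> * A = (B / A + C / A + \<gamma>) * A"
    using A by (simp add: field_simps)
  ultimately show ?thesis using A by simp
qed

text \<open>
  \<open>apolar_weight \<gamma> d i j\<close> is what becomes of \<open>u\<^sup>i v\<^sup>j\<close> after \<open>d\<close> rounds of splitting off one
  variable from \<open>u\<close> and one from \<open>v\<close> and applying \<open>\<partial>\<^sub>\<zeta> + \<partial>\<^sub>\<eta> + \<gamma>\<close> to this new pair at
  the origin; the bound on both degrees drops by one in each round. Splitting replaces \<open>u\<^sup>i\<close> by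
  \<open>(M - i) u\<^sup>i + \<zeta> i u\<^bsup>i-1\<^esup>\<close> when \<open>M\<close> is the current bound. Equivalently, it is
  the value at the origin of \<open>(d!)\<^sup>2 \<Prod>\<^sub>l (\<partial>/\<partial>x\<^sub>l + \<partial>/\<partial>y\<^sub>l + \<gamma>)\<close>, \<open>l\<close> ranging from \<open>1\<close> to \<open>d\<close>, on the
  polarization of \<open>u\<^sup>i v\<^sup>j\<close> in \<open>x\<^sub>1, \<dots>, x\<^sub>d\<close> and \<open>y\<^sub>1, \<dots>, y\<^sub>d\<close>.
\<close>

primrec apolar_weight :: "complex \<Rightarrow> nat \<Rightarrow> nat \<Rightarrow> nat \<Rightarrow> complex" where
  "apolar_weight \<gamma> 0 i j = (if i = 0 \<and> j = 0 then 1 else 0)"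
| "apolar_weight \<gamma> (Suc m) i j =
     of_nat i * of_nat (Suc m - j) * apolar_weight \<gamma> m (i - 1) j +
     of_nat j * of_nat (Suc m - i) * apolar_weight \<gamma> m i (j - 1) +
     \<gamma> * of_nat (Suc m - i) * of_nat (Suc m - j) * apolar_weight \<gamma> m i j"

lemma tendsto_apolar_weight:
  assumes "(g \<longlongrightarrow> \<gamma>) F"
  shows "((\<lambda>x. apolar_weight (g x) d i j) \<longlongrightarrow> apolar_weight \<gamma> d i j) F"
  by (induction d arbitrary: i j) (auto intro!: tendsto_intros assms)

text \<open>
  At \<open>\<gamma> = 0\<close> the weights are, up to constants and signs, those of Grace's apolar pairing, and
  they are proportional to those with which the operator weighs the Taylor coefficients.
\<close>

lemma apolar_weight_0:
  "apolar_weight 0 d i j = (if i + j = d then fact d * fact i * fact j else 0)"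
proof (induction d arbitrary: i j)
  case (Suc m)
  show ?case
  proof (cases i; cases j)
    fix i' j' assume ij: "i = Suc i'" "j = Suc j'"
    show ?thesis
    proof (cases "i + j = Suc m")
      case True
      then have "Suc m - j = i" "Suc m - i = j" "m = i' + j" using ij by auto
      moreover have M: "1 + complex_of_nat m = of_nat i + of_nat j"
        using True by (metis of_nat_Suc of_nat_add)
      ultimately show ?thesis using True Suc.IH[of i' j] Suc.IH[of i j'] Suc.IH[of i j] ij
        by simp (simp add: algebra_simps)
    qed (use Suc.IH ij in auto)
  qed (use Suc.IH in \<open>auto\<close>)
qed auto

text \<open>
  One round takes the monomials of degree at most \<open>m + 1\<close> in each variable to combinations of those
  of degree at most \<open>m\<close>, because the factors \<open>of_nat (Suc m - i)\<close> and \<open>of_nat i\<close> vanish at the two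
  ends of the range. The function \<open>G\<close> will be instantiated both with the monomials \<open>u\<^sup>i v\<^sup>j\<close> and with
  the weights, which are thereby seen to satisfy the same recursion.
\<close>

lemma reduce_bidegree:
  fixes c G :: "nat \<Rightarrow> nat \<Rightarrow> complex" and \<gamma> :: complex
  shows "(\<Sum>i\<le>Suc m. \<Sum>j\<le>Suc m. c i j *
      (of_nat i * of_nat (Suc m - j) * G (i - 1) j + of_nat j * of_nat (Suc m - i) * G i (j - 1) +
       \<gamma> * of_nat (Suc m - i) * of_nat (Suc m - j) * G i j)) =
    (\<Sum>i\<le>m. \<Sum>j\<le>m.
      (of_nat (Suc i) * of_nat (Suc m - j) * c (Suc i) j +
       of_nat (Suc j) * of_nat (Suc m - i) * c i (Suc j) +
       \<gamma> * of_nat (Suc m - i) * of_nat (Suc m - j) * c i j) * G i j)"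
proof -
  have drop: "(\<Sum>i\<le>Suc m. of_nat (Suc m - i) * f i) = (\<Sum>i\<le>m. of_nat (Suc m - i) * f i)"
    for f :: "nat \<Rightarrow> complex" by simp
  have shift: "(\<Sum>i\<le>Suc m. of_nat i * f i) = (\<Sum>i\<le>m. of_nat (Suc i) * f (Suc i))"
    for f :: "nat \<Rightarrow> complex" by (subst sum.atMost_Suc_shift) simp
  have "(\<Sum>i\<le>Suc m. \<Sum>j\<le>Suc m. c i j *
      (of_nat i * of_nat (Suc m - j) * G (i - 1) j + of_nat j * of_nat (Suc m - i) * G i (j - 1) +
       \<gamma> * of_nat (Suc m - i) * of_nat (Suc m - j) * G i j)) =
    (\<Sum>i\<le>Suc m. of_nat i * (\<Sum>j\<le>Suc m. of_nat (Suc m - j) * (c i j * G (i - 1) j))) +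
    (\<Sum>i\<le>Suc m. of_nat (Suc m - i) * (\<Sum>j\<le>Suc m. of_nat j * (c i j * G i (j - 1)))) +
    (\<Sum>i\<le>Suc m. of_nat (Suc m - i) * (\<Sum>j\<le>Suc m. of_nat (Suc m - j) * (\<gamma> * c i j * G i j)))"
    by (simp only: sum.distrib[symmetric] sum_distrib_left distrib_left mult_ac)
  also have "\<dots> = (\<Sum>i\<le>m. of_nat (Suc i) * (\<Sum>j\<le>m. of_nat (Suc m - j) * (c (Suc i) j * G i j))) +
    (\<Sum>i\<le>m. of_nat (Suc m - i) * (\<Sum>j\<le>m. of_nat (Suc j) * (c i (Suc j) * G i j))) +
    (\<Sum>i\<le>m. of_nat (Suc m - i) * (\<Sum>j\<le>m. of_nat (Suc m - j) * (\<gamma> * c i j * G i j)))"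
    by (simp only: drop shift diff_Suc_1)
  also have "\<dots> = (\<Sum>i\<le>m. \<Sum>j\<le>m.
      (of_nat (Suc i) * of_nat (Suc m - j) * c (Suc i) j +
       of_nat (Suc j) * of_nat (Suc m - i) * c i (Suc j) +
       \<gamma> * of_nat (Suc m - i) * of_nat (Suc m - j) * c i j) * G i j)"
    by (simp only: sum.distrib[symmetric] sum_distrib_left distrib_left distrib_right mult_ac)
  finally show ?thesis .
qed

text \<open>
  A two-variable analogue of Grace's theorem. Each round preserves nonvanishing: Laguerre's theorem
  in \<open>u\<close> and then in \<open>v\<close> yields a polynomial in \<open>u\<close>, \<open>v\<close>, \<open>\<zeta>\<close>, \<open>\<eta>\<close> without zeros in the
  half-planes, which is biaffine in \<open>\<zeta>\<close> and \<open>\<eta>\<close>. The bounds \<open>a\<close> and \<open>b\<close> are negative so that the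
  closed upper half-planes, and in particular the origin, are available for \<open>\<zeta>\<close> and \<open>\<eta>\<close>.
\<close>

lemma apolar_weight_nonvanishing:
  fixes c :: "nat \<Rightarrow> nat \<Rightarrow> complex"
  assumes a: "a < 0" and b: "b < 0" and \<gamma>: "Im \<gamma> < 0"
    and nz: "\<And>u v. Im u > a \<Longrightarrow> Im v > b \<Longrightarrow> (\<Sum>i\<le>d. \<Sum>j\<le>d. c i j * (u ^ i * v ^ j)) \<noteq> 0"
  shows "(\<Sum>i\<le>d. \<Sum>j\<le>d. c i j * apolar_weight \<gamma> d i j) \<noteq> 0"
  using nz
proof (induction d arbitrary: c)
  case 0
  show ?case using "0.prems"[of 0 0] a b by simp
next
  case (Suc m)
  let ?M = "Suc m"
  define c' where "c' i j = of_nat (Suc i) * of_nat (?M - j) * c (Suc i) j +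
       of_nat (Suc j) * of_nat (?M - i) * c i (Suc j) +
       \<gamma> * of_nat (?M - i) * of_nat (?M - j) * c i j" for i j
  have "(\<Sum>i\<le>m. \<Sum>j\<le>m. c' i j * (u ^ i * v ^ j)) \<noteq> 0" if u: "Im u > a" and v: "Im v > b" for u v
  proof -
    let ?P = "\<lambda>i. of_nat (?M - i) * u ^ i" and ?P' = "\<lambda>i. of_nat i * u ^ (i - 1)"
    let ?Q = "\<lambda>j. of_nat (?M - j) * v ^ j" and ?Q' = "\<lambda>j. of_nat j * v ^ (j - 1)"
    have polar2: "(\<Sum>j\<le>?M. (\<Sum>i\<le>?M. c i j * (?P i + \<zeta> * ?P' i)) * (?Q j + \<eta> * ?Q' j)) \<noteq> 0"
      if \<zeta>: "Im \<zeta> > a" and \<eta>: "Im \<eta> > b" for \<zeta> \<eta>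
    proof (rule Laguerre_polar_derivative[OF _ _ v \<eta>])
      fix y assume y: "Im y > b"
      have "(\<Sum>i\<le>?M. (\<Sum>j\<le>?M. c i j * y ^ j) * (?P i + \<zeta> * ?P' i)) \<noteq> 0"
      proof (rule Laguerre_polar_derivative[OF _ _ u \<zeta>])
        fix x assume "Im x > a"
        from Suc.prems[OF this y] show "(\<Sum>i\<le>?M. (\<Sum>j\<le>?M. c i j * y ^ j) * x ^ i) \<noteq> 0"
          by (simp only: sum_distrib_left sum_distrib_right mult_ac not_False_eq_True)
      qed simp
      also have "(\<Sum>i\<le>?M. (\<Sum>j\<le>?M. c i j * y ^ j) * (?P i + \<zeta> * ?P' i)) =
          (\<Sum>i\<le>?M. \<Sum>j\<le>?M. c i j * (?P i + \<zeta> * ?P' i) * y ^ j)"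
        by (simp only: sum_distrib_left sum_distrib_right mult_ac)
      also have "\<dots> = (\<Sum>j\<le>?M. \<Sum>i\<le>?M. c i j * (?P i + \<zeta> * ?P' i) * y ^ j)"
        by (rule sum.swap)
      also have "\<dots> = (\<Sum>j\<le>?M. (\<Sum>i\<le>?M. c i j * (?P i + \<zeta> * ?P' i)) * y ^ j)"
        by (simp only: sum_distrib_right)
      finally show "(\<Sum>j\<le>?M. (\<Sum>i\<le>?M. c i j * (?P i + \<zeta> * ?P' i)) * y ^ j) \<noteq> 0" .
    qed simp
    \<comment> \<open>The polynomial with \<open>u\<^sup>i\<close> and \<open>v\<^sup>j\<close> replaced by \<open>f i\<close> and \<open>g j\<close>; the four choices
      from \<open>?P\<close>, \<open>?P'\<close> and \<open>?Q\<close>, \<open>?Q'\<close> give the coefficients of the biaffine polynomial.\<close>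
    define S where "S f g = (\<Sum>i\<le>?M. \<Sum>j\<le>?M. c i j * (f i * g j))" for f g :: "nat \<Rightarrow> complex"
    have expand: "(\<Sum>j\<le>?M. (\<Sum>i\<le>?M. c i j * (?P i + \<zeta> * ?P' i)) * (?Q j + \<eta> * ?Q' j)) =
        S ?P ?Q + S ?P' ?Q * \<zeta> + S ?P ?Q' * \<eta> + S ?P' ?Q' * \<zeta> * \<eta>" for \<zeta> \<eta>
    proof -
      have "(\<Sum>j\<le>?M. (\<Sum>i\<le>?M. c i j * (?P i + \<zeta> * ?P' i)) * (?Q j + \<eta> * ?Q' j)) =
          (\<Sum>j\<le>?M. \<Sum>i\<le>?M. c i j * (?P i + \<zeta> * ?P' i) * (?Q j + \<eta> * ?Q' j))"
        by (simp only: sum_distrib_right)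
      also have "\<dots> = (\<Sum>i\<le>?M. \<Sum>j\<le>?M. c i j * (?P i + \<zeta> * ?P' i) * (?Q j + \<eta> * ?Q' j))"
        by (rule sum.swap)
      also have "\<dots> = S ?P ?Q + S ?P' ?Q * \<zeta> + S ?P ?Q' * \<eta> + S ?P' ?Q' * \<zeta> * \<eta>"
        unfolding S_def sum_distrib_right sum.distrib[symmetric]
        by (intro sum.cong refl) (simp only: distrib_left distrib_right mult_ac add_ac)
      finally show ?thesis .
    qed
    have "S ?P' ?Q + S ?P ?Q' + \<gamma> * S ?P ?Q \<noteq> 0"
    proof (rule biaffine_nonvanishing[where D = "S ?P' ?Q'", OF _ \<gamma>])
      fix \<zeta> \<eta> :: complex assume "Im \<zeta> \<ge> 0" "Im \<eta> \<ge> 0"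
      then show "S ?P ?Q + S ?P' ?Q * \<zeta> + S ?P ?Q' * \<eta> + S ?P' ?Q' * \<zeta> * \<eta> \<noteq> 0"
        using polar2[of \<zeta> \<eta>] a b unfolding expand by simp
    qed
    also have "S ?P' ?Q + S ?P ?Q' + \<gamma> * S ?P ?Q = (\<Sum>i\<le>?M. \<Sum>j\<le>?M. c i j *
      (of_nat i * of_nat (?M - j) * (u ^ (i - 1) * v ^ j) +
       of_nat j * of_nat (?M - i) * (u ^ i * v ^ (j - 1)) +
       \<gamma> * of_nat (?M - i) * of_nat (?M - j) * (u ^ i * v ^ j)))"
      unfolding S_def sum_distrib_left sum.distrib[symmetric]
      by (intro sum.cong refl) (simp only: distrib_left distrib_right mult_ac add_ac)
    also have "\<dots> = (\<Sum>i\<le>m. \<Sum>j\<le>m. c' i j * (u ^ i * v ^ j))"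
      unfolding c'_def by (rule reduce_bidegree)
    finally show ?thesis .
  qed
  then have "(\<Sum>i\<le>m. \<Sum>j\<le>m. c' i j * apolar_weight \<gamma> m i j) \<noteq> 0"
    by (rule Suc.IH)
  then show ?case
    unfolding c'_def apolar_weight.simps reduce_bidegree .
qed

section \<open>The operator in terms of Taylor coefficients\<close>

lemma keys_mp_deriv_funpow:
  assumes "m \<in> Poly_Mapping.keys ((mp_deriv i ^^ k) f)"
  shows "m + Poly_Mapping.single i k \<in> Poly_Mapping.keys f"
  using assms
proof (induction k arbitrary: m)
  case (Suc k)
  then have "m + Poly_Mapping.single i 1 \<in> Poly_Mapping.keys ((mp_deriv i ^^ k) f)"
    by (auto simp: in_keys_iff lookup_mp_deriv)
  from Suc.IH[OF this] show ?case
    by (simp add: add.assoc flip: single_add)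
qed simp

lemma mp_deriv_funpow_eq_0:
  assumes "deg_in i f < k"
  shows "(mp_deriv i ^^ k) f = 0"
proof -
  have False if "m \<in> Poly_Mapping.keys ((mp_deriv i ^^ k) f)" for m
    using keys_mp_deriv_funpow[OF that] assms deg_in_le_iff[of i f "deg_in i f"]
    by (fastforce simp: lookup_add)
  then show ?thesis by (metis keys_eq_empty all_not_in_conv)
qed

lemma mp_eval_Taylor:
  assumes "deg_in i f \<le> N"
  shows "mp_eval (z(i := z i + u)) f = (\<Sum>k\<le>N. mp_eval z ((mp_deriv i ^^ k) f) * u ^ k / fact k)"
proof -
  define F where "F k t = mp_eval (z(i := t)) ((mp_deriv i ^^ k) f)" for k t
  have "norm (F 0 (z i + u) - (\<Sum>k\<le>N. F k (z i) * (z i + u - z i) ^ k / fact k))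
      \<le> 0 * norm (z i + u - z i) ^ Suc N / fact N"
  proof (rule complex_Taylor[of UNIV])
    show "(F k has_field_derivative F (Suc k) x) (at x within UNIV)" for k x
      unfolding F_def by (simp add: mp_eval_deriv)
    have "(mp_deriv i ^^ Suc N) f = 0"
      using assms by (intro mp_deriv_funpow_eq_0) simp
    then show "norm (F (Suc N) x) \<le> 0" for x
      by (simp only: F_def mp_eval_0 norm_zero order_refl)
  qed auto
  then show ?thesis by (simp add: F_def fun_upd_idem)
qed

definition taylor_coeff :: "cmpoly \<Rightarrow> (nat \<Rightarrow> complex) \<Rightarrow> nat \<Rightarrow> nat \<Rightarrow> complex" where
  "taylor_coeff f z i j =
     mp_eval z ((mp_deriv 1 ^^ i) ((mp_deriv 2 ^^ j) f)) / (fact i * fact j)"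

lemma mp_deriv_funpow_in_poly_space:
  assumes "f \<in> poly_space n \<kappa>"
  shows "(mp_deriv i ^^ k) f \<in> poly_space n \<kappa>"
  using assms by (induction k) (simp_all add: mp_deriv_in_poly_space)

lemma mp_eval_two_variable_Taylor:
  assumes f: "f \<in> poly_space n \<kappa>" and n: "n \<ge> 2" and \<kappa>: "\<kappa> 1 = d" "\<kappa> 2 = d"
  shows "mp_eval (z(1 := z 1 + u, 2 := z 2 + v)) f =
    (\<Sum>i\<le>d. \<Sum>j\<le>d. taylor_coeff f z i j * (u ^ i * v ^ j))"
proof -
  have "deg_in 1 g \<le> d" "deg_in 2 g \<le> d" if "g \<in> poly_space n \<kappa>" for g
  proof -
    have "1 \<in> {1..n}" "2 \<in> {1..n}" using n by auto
    moreover have "\<forall>i\<in>{1..n}. deg_in i g \<le> \<kappa> i"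
      using that by (simp add: poly_space_def)
    ultimately have "deg_in 1 g \<le> \<kappa> 1" "deg_in 2 g \<le> \<kappa> 2" by blast+
    then show "deg_in 1 g \<le> d" "deg_in 2 g \<le> d" using \<kappa> by simp_all
  qed
  note deg = this[OF mp_deriv_funpow_in_poly_space[OF f]] this[OF f]
  let ?z = "z(1 := z 1 + u)"
  have "mp_eval (?z(2 := ?z 2 + v)) f =
      (\<Sum>j\<le>d. mp_eval ?z ((mp_deriv 2 ^^ j) f) * v ^ j / fact j)"
    by (rule mp_eval_Taylor) (rule deg)
  also have "\<dots> = (\<Sum>j\<le>d. \<Sum>i\<le>d. taylor_coeff f z i j * (u ^ i * v ^ j))"
    by (subst mp_eval_Taylor[OF deg(1)])
       (simp add: taylor_coeff_def sum_distrib_left sum_distrib_right sum_divide_distrib mult_ac)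
  also have "\<dots> = (\<Sum>i\<le>d. \<Sum>j\<le>d. taylor_coeff f z i j * (u ^ i * v ^ j))"
    by (rule sum.swap)
  finally show ?thesis by simp
qed

lemma mp_eval_scale: "mp_eval z (mp_scale c f) = c * mp_eval z f"
proof -
  have "Poly_Mapping.keys (mp_scale c f) \<subseteq> Poly_Mapping.keys f"
    by (auto simp: in_keys_iff)
  then show ?thesis
    by (simp add: mp_eval_superset[of "Poly_Mapping.keys f"] sum_distrib_left mult_ac)
qed

lemma mp_eval_T_op:
  "fact d * mp_eval z (T_op d f) = (\<Sum>k\<le>d. fact k * fact (d - k) * taylor_coeff f z k (d - k))"
  by (simp add: T_op_def mp_eval_scale mp_eval_sum taylor_coeff_def atLeast0AtMost)

lemma apolar_weight_0_T_op:
  "(\<Sum>i\<le>d. \<Sum>j\<le>d. taylor_coeff f z i j * \<omega> ^ (i + j) * apolar_weight 0 d i j) =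
     (fact d)\<^sup>2 * \<omega> ^ d * mp_eval z (T_op d f)"
proof -
  have "(\<Sum>j\<le>d. taylor_coeff f z i j * \<omega> ^ (i + j) * apolar_weight 0 d i j) =
      fact d * \<omega> ^ d * (fact i * fact (d - i) * taylor_coeff f z i (d - i))" if i: "i \<le> d" for i
  proof -
    have "(\<Sum>j\<le>d. taylor_coeff f z i j * \<omega> ^ (i + j) * apolar_weight 0 d i j) =
        (\<Sum>j\<in>{d - i}. taylor_coeff f z i j * \<omega> ^ (i + j) * apolar_weight 0 d i j)"
      using i by (intro sum.mono_neutral_right) (auto simp: apolar_weight_0)
    then show ?thesis using i by (simp add: apolar_weight_0)
  qed
  then have "(\<Sum>i\<le>d. \<Sum>j\<le>d. taylor_coeff f z i j * \<omega> ^ (i + j) * apolar_weight 0 d i j) =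
      fact d * \<omega> ^ d * (\<Sum>k\<le>d. fact k * fact (d - k) * taylor_coeff f z k (d - k))"
    by (simp add: sum_distrib_left)
  then show ?thesis
    unfolding mp_eval_T_op[symmetric] by (simp add: power2_eq_square)
qed

text \<open>
  The Taylor polynomial of \<open>f\<close> at \<open>z\<close> in the first two variables, with increments rotated by
  \<open>exp (- (\<i> * of_real \<theta>))\<close>, has no zeros \<open>u\<close>, \<open>v\<close> with \<open>Im u\<close> and \<open>Im v\<close> above certain negative
  bounds, namely minus the distances of \<open>z 1\<close> and \<open>z 2\<close> to the boundary of the half-plane.
\<close>

lemma apolar_weight_stable:
  assumes f: "f \<in> poly_space n \<kappa>" and n: "n \<ge> 2" and \<kappa>: "\<kappa> 1 = d" "\<kappa> 2 = d"
    and stable: "stable n \<theta> f" and z: "\<forall>i\<in>{1..n}. z i \<in> half_plane \<theta>" and \<gamma>: "Im \<gamma> < 0"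
  shows "(\<Sum>i\<le>d. \<Sum>j\<le>d. taylor_coeff f z i j * exp (- (\<i> * of_real \<theta>)) ^ (i + j) *
    apolar_weight \<gamma> d i j) \<noteq> 0"
proof (rule apolar_weight_nonvanishing[OF _ _ \<gamma>])
  let ?e = "exp (\<i> * complex_of_real \<theta>)" and ?\<omega> = "exp (- (\<i> * complex_of_real \<theta>))"
  have "1 \<in> {1..n}" "2 \<in> {1..n}" using n by auto
  with z show "- Im (?e * z 1) < 0" "- Im (?e * z 2) < 0"
    unfolding half_plane_def by fastforce+
  fix u v assume u: "- Im (?e * z 1) < Im u" and v: "- Im (?e * z 2) < Im v"
  have rot: "?e * (x + ?\<omega> * y) = ?e * x + y" for x y
    by (simp add: distrib_left mult.assoc[symmetric] flip: exp_add)
  have "mp_eval (z(1 := z 1 + ?\<omega> * u, 2 := z 2 + ?\<omega> * v)) f \<noteq> 0"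
    using stable z u v unfolding stable_def
    by (auto simp: half_plane_def rot simp del: times_complex.sel)
  then show "(\<Sum>i\<le>d. \<Sum>j\<le>d. taylor_coeff f z i j * ?\<omega> ^ (i + j) * (u ^ i * v ^ j)) \<noteq> 0"
    unfolding mp_eval_two_variable_Taylor[OF f n \<kappa>] power_mult_distrib power_add
    by (simp only: mult_ac not_False_eq_True)
qed

section \<open>A zero of the image forces the image to vanish\<close>

lemma holomorphic_mp_eval_line:
  "(\<lambda>t. mp_eval (\<lambda>i. p i + t * q i) f) holomorphic_on S"
  unfolding mp_eval_def by (intro holomorphic_intros)

lemma half_plane_line:
  shows "open {t. p + t * q \<in> half_plane \<theta>}" "convex {t. p + t * q \<in> half_plane \<theta>}"
proof -
  let ?e = "exp (\<i> * complex_of_real \<theta>)"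
  have eq: "{t. p + t * q \<in> half_plane \<theta>} = {t. Im (?e * p + ?e * q * t) > 0}"
    by (simp add: half_plane_def algebra_simps)
  show "open {t. p + t * q \<in> half_plane \<theta>}"
    unfolding eq by (intro open_Collect_less continuous_intros)
  have "{t. p + t * q \<in> half_plane \<theta>} = (\<lambda>t. ?e * q * t) -` {w. Im w > - Im (?e * p)}"
    unfolding eq by auto
  also have "convex \<dots>"
    by (intro convex_linear_vimage convex_halfspace_Im_gt linear_times)
  finally show "convex {t. p + t * q \<in> half_plane \<theta>}" .
qed

lemma uniform_limit_sum:
  fixes f :: "'i \<Rightarrow> 'b \<Rightarrow> 'a \<Rightarrow> 'c::real_normed_vector"
  assumes "\<And>i. i \<in> I \<Longrightarrow> uniform_limit S (f i) (l i) F"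
  shows "uniform_limit S (\<lambda>n x. \<Sum>i\<in>I. f i n x) (\<lambda>x. \<Sum>i\<in>I. l i x) F"
  using assms
  by (induction I rule: infinite_finite_induct) (auto intro!: uniform_limit_intros)

text \<open>
  The perturbed functionals have no zeros for \<open>Im \<gamma> < 0\<close>, and for \<open>\<gamma> \<rightarrow> 0\<close> they
  converge to the operator, up to a nonzero factor. Restricted to the complex line through \<open>p\<close> and
  \<open>q\<close>, Hurwitz's theorem leaves for the limit only the alternatives of having no zero and of being
  constant. The parameters of the line that keep all variables in the half-plane form an open convex
  set, hence a connected one.
\<close>

lemma T_op_zero_everywhere:
  assumes f: "f \<in> poly_space n \<kappa>" and n: "n \<ge> 2" and \<kappa>: "\<kappa> 1 = d" "\<kappa> 2 = d"
    and stable: "stable n \<theta> f"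
    and p: "\<forall>i\<in>{1..n}. p i \<in> half_plane \<theta>" and q: "\<forall>i\<in>{1..n}. q i \<in> half_plane \<theta>"
    and zero: "mp_eval p (T_op d f) = 0"
  shows "mp_eval q (T_op d f) = 0"
proof (rule ccontr)
  assume nonzero: "mp_eval q (T_op d f) \<noteq> 0"
  define \<omega> where "\<omega> = exp (- (\<i> * complex_of_real \<theta>))"
  define z where "z t i = p i + t * (q i - p i)" for t i
  define S where "S = {t. \<forall>i\<in>{1..n}. z t i \<in> half_plane \<theta>}"
  define \<Phi> where "\<Phi> \<gamma> t = (\<Sum>i\<le>d. \<Sum>j\<le>d. taylor_coeff f (z t) i j * \<omega> ^ (i + j) *
    apolar_weight \<gamma> d i j)" for \<gamma> t
  define \<gamma> where "\<gamma> N = - (\<i> * of_real (1 / real (Suc N)))" for N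
  have S: "S = (\<Inter>i\<in>{1..n}. {t. p i + t * (q i - p i) \<in> half_plane \<theta>})"
    by (auto simp: S_def z_def)
  have "open S" unfolding S by (intro open_INT ballI half_plane_line) simp
  have "convex S" unfolding S by (intro convex_INT half_plane_line)
  have zpq: "z 0 = p" "z 1 = q" by (auto simp: z_def)
  with p q have pq: "0 \<in> S" "1 \<in> S" by (auto simp: S_def)
  have \<Phi>0: "\<Phi> 0 t = (fact d)\<^sup>2 * \<omega> ^ d * mp_eval (z t) (T_op d f)" for t
    unfolding \<Phi>_def by (rule apolar_weight_0_T_op)
  have hol: "(\<lambda>t. taylor_coeff f (z t) i j) holomorphic_on A" for i j A
    unfolding taylor_coeff_def z_def by (intro holomorphic_intros holomorphic_mp_eval_line) auto
  have hol\<Phi>: "\<Phi> c holomorphic_on S" for c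
    unfolding \<Phi>_def[abs_def] by (intro holomorphic_intros hol)
  have "(\<lambda>N. 1 / real (Suc N)) \<longlonglongrightarrow> 0"
    using LIMSEQ_inverse_real_of_nat by (simp add: inverse_eq_divide)
  then have "\<gamma> \<longlonglongrightarrow> - (\<i> * of_real 0)"
    unfolding \<gamma>_def by (intro tendsto_intros)
  then have \<gamma>: "\<gamma> \<longlonglongrightarrow> 0" by simp
  have unif: "uniform_limit K (\<lambda>N. \<Phi> (\<gamma> N)) (\<Phi> 0) sequentially" if K: "compact K" for K
  proof -
    have summand: "uniform_limit K
        (\<lambda>N t. taylor_coeff f (z t) i j * \<omega> ^ (i + j) * apolar_weight (\<gamma> N) d i j)
        (\<lambda>t. taylor_coeff f (z t) i j * \<omega> ^ (i + j) * apolar_weight 0 d i j) sequentially" for i j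
    proof (rule uniform_lim_mult)
      have "continuous_on K (\<lambda>t. taylor_coeff f (z t) i j * \<omega> ^ (i + j))"
        by (intro continuous_intros holomorphic_on_imp_continuous_on hol)
      then show "bounded ((\<lambda>t. taylor_coeff f (z t) i j * \<omega> ^ (i + j)) ` K)"
        using K by (intro compact_imp_bounded compact_continuous_image)
      show "uniform_limit K (\<lambda>N t. apolar_weight (\<gamma> N) d i j) (\<lambda>t. apolar_weight 0 d i j) sequentially"
      proof (rule uniform_limitI)
        fix e :: real assume "e > 0"
        with tendsto_apolar_weight[OF \<gamma>, of d i j]
        show "\<forall>\<^sub>F N in sequentially. \<forall>t\<in>K. dist (apolar_weight (\<gamma> N) d i j) (apolar_weight 0 d i j) < e"
          by (auto simp: tendsto_iff elim: eventually_mono)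
      qed
      show "bounded ((\<lambda>t. apolar_weight 0 d i j) ` K)"
        by (rule bounded_subset[of "{apolar_weight 0 d i j}"]) auto
    qed (rule uniform_limit_const)
    show ?thesis
      unfolding \<Phi>_def[abs_def] by (intro uniform_limit_sum summand)
  qed
  have "\<Phi> 0 0 \<noteq> 0"
  proof (rule Hurwitz_no_zeros[where g = "\<Phi> 0" and ?z0.0 = 0 and S = S])
    show "\<not> \<Phi> 0 constant_on S"
    proof
      assume "\<Phi> 0 constant_on S"
      then have "\<Phi> 0 0 = \<Phi> 0 1" using pq unfolding constant_on_def by metis
      then show False using zero nonzero by (simp add: \<Phi>0 zpq \<omega>_def)
    qed
    show "\<Phi> (\<gamma> N) t \<noteq> 0" if "t \<in> S" for N t
      unfolding \<Phi>_def \<omega>_def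
    proof (rule apolar_weight_stable[OF f n \<kappa> stable])
      show "\<forall>i\<in>{1..n}. z t i \<in> half_plane \<theta>" using that by (simp add: S_def)
      show "Im (\<gamma> N) < 0" by (simp add: \<gamma>_def)
    qed
  qed (use \<open>open S\<close> \<open>convex S\<close> convex_connected hol\<Phi> unif pq in auto)
  then show False using zero by (simp add: \<Phi>0 zpq)
qed

lemma mp_deriv_vanishes:
  assumes g: "\<And>z. \<forall>i\<in>{1..n}. z i \<in> half_plane \<theta> \<Longrightarrow> mp_eval z g = 0"
    and z: "\<forall>i\<in>{1..n}. z i \<in> half_plane \<theta>"
  shows "mp_eval z (mp_deriv k g) = 0"
proof -
  \<comment> \<open>A variable outside the range is unconstrained, so it may move in the whole plane.\<close>
  let ?U = "if k \<in> {1..n} then half_plane \<theta> else UNIV"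
  have "half_plane \<theta> = {t. 0 + t * 1 \<in> half_plane \<theta>}" by simp
  then have "open ?U" using half_plane_line(1)[of 0 1 \<theta>] by simp
  moreover have "z k \<in> ?U" using z by simp
  ultimately have "\<forall>\<^sub>F t in nhds (z k). t \<in> ?U" by (rule eventually_nhds_in_open)
  then have ev: "\<forall>\<^sub>F t in nhds (z k). mp_eval (z(k := t)) g = 0"
  proof eventually_elim
    case (elim t)
    then show ?case using z by (intro g) (auto split: if_splits)
  qed
  have "((\<lambda>t. mp_eval (z(k := t)) g) has_field_derivative mp_eval (z(k := z k)) (mp_deriv k g))
      (at (z k))"
    by (rule mp_eval_deriv)
  moreover have "((\<lambda>t. mp_eval (z(k := t)) g) has_field_derivative 0) (at (z k))"
    using ev DERIV_cong_ev[of "z k" "z k" "\<lambda>t. mp_eval (z(k := t)) g" "\<lambda>t. 0" 0 0] by simp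
  ultimately show ?thesis using DERIV_unique by fastforce
qed

lemma mp_eval_at_0: "mp_eval (\<lambda>_. 0) g = Poly_Mapping.lookup g 0"
proof -
  have "mp_eval (\<lambda>_. 0) g = (\<Sum>m\<in>insert 0 (Poly_Mapping.keys g). Poly_Mapping.lookup g m *
      (\<Prod>i\<in>Poly_Mapping.keys m. 0 ^ Poly_Mapping.lookup m i))"
    by (rule mp_eval_superset) auto
  also have "\<dots> = (\<Sum>m\<in>{0}. Poly_Mapping.lookup g m *
      (\<Prod>i\<in>Poly_Mapping.keys m. 0 ^ Poly_Mapping.lookup m i))"
  proof (intro sum.mono_neutral_right ballI)
    fix m :: "nat \<Rightarrow>\<^sub>0 nat" assume "m \<in> insert 0 (Poly_Mapping.keys g) - {0}"
    then obtain i where "i \<in> Poly_Mapping.keys m"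
      by (metis DiffE all_not_in_conv keys_eq_empty singletonI)
    then show "Poly_Mapping.lookup g m *
        (\<Prod>i\<in>Poly_Mapping.keys m. (0::complex) ^ Poly_Mapping.lookup m i) = 0"
      by (auto simp: in_keys_iff power_0_left)
  qed auto
  finally show ?thesis by simp
qed

text \<open>
  The origin lies on the boundary of the half-plane, so the constant coefficient is a limit of
  values at points that approach the origin along the inner normal.
\<close>

lemma constant_coeff_vanishes:
  assumes g: "\<And>z. \<forall>i\<in>{1..n}. z i \<in> half_plane \<theta> \<Longrightarrow> mp_eval z g = 0"
  shows "Poly_Mapping.lookup g 0 = 0"
proof -
  let ?w = "exp (- (\<i> * complex_of_real \<theta>)) * \<i>"
  let ?F = "\<lambda>t. mp_eval (\<lambda>i. 0 + t * ?w) g"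
  have "isCont ?F 0"
    using holomorphic_on_imp_continuous_on[OF holomorphic_mp_eval_line[of "\<lambda>_. 0" "\<lambda>_. ?w" g UNIV]]
    by (simp add: continuous_on_eq_continuous_at)
  moreover have "(\<lambda>N. complex_of_real (inverse (real (Suc N)))) \<longlonglongrightarrow> of_real 0"
    by (intro tendsto_of_real LIMSEQ_inverse_real_of_nat)
  ultimately have "(\<lambda>N. ?F (of_real (inverse (real (Suc N))))) \<longlonglongrightarrow> ?F 0"
    using isCont_tendsto_compose[of 0 ?F] by simp
  moreover have "?F (of_real (inverse (real (Suc N)))) = 0" for N
  proof (rule g, intro ballI)
    have "exp (\<i> * complex_of_real \<theta>) * (x * ?w) =
        exp (\<i> * complex_of_real \<theta>) * exp (- (\<i> * complex_of_real \<theta>)) * (x * \<i>)" for x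
      by (simp only: mult_ac)
    then have rot: "exp (\<i> * complex_of_real \<theta>) * (x * ?w) = x * \<i>" for x
      by (simp only: exp_minus_inverse mult_1)
    then show "0 + of_real (inverse (real (Suc N))) * ?w \<in> half_plane \<theta>"
      unfolding half_plane_def mem_Collect_eq add_0 rot by (simp del: of_nat_Suc)
  qed
  ultimately have "?F 0 = 0" by (simp add: LIMSEQ_const_iff)
  then show ?thesis by (simp add: mp_eval_at_0)
qed

text \<open>
  Partial derivatives inherit the hypothesis. As the coefficient of a monomial is a positive multiple
  of the constant coefficient of the corresponding derivative, induction on the total
  degree of the monomial reduces every coefficient to the constant one.
\<close>

lemma vanishing_imp_zero:
  assumes "\<And>z. \<forall>i\<in>{1..n}. z i \<in> half_plane \<theta> \<Longrightarrow> mp_eval z g = 0"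
  shows "g = 0"
proof (rule poly_mapping_eqI)
  fix m :: "nat \<Rightarrow>\<^sub>0 nat"
  have "Poly_Mapping.lookup g m = 0"
    if "(\<Sum>i\<in>Poly_Mapping.keys m. Poly_Mapping.lookup m i) = N"
      and "\<And>z. \<forall>i\<in>{1..n}. z i \<in> half_plane \<theta> \<Longrightarrow> mp_eval z g = 0" for N
    using that
  proof (induction N arbitrary: m g)
    case 0
    then have "m = 0" by (metis (no_types) finite_keys in_keys_iff keys_eq_empty all_not_in_conv sum_eq_0_iff)
    then show ?case using constant_coeff_vanishes[OF "0.prems"(2)] by simp
  next
    case (Suc N)
    then obtain i where i: "i \<in> Poly_Mapping.keys m"
      by (metis all_not_in_conv sum.empty nat.distinct(1))
    define m' where "m' = m - Poly_Mapping.single i 1"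
    have m: "m = m' + Poly_Mapping.single i 1"
      using i by (intro poly_mapping_eqI)
        (auto simp: m'_def lookup_add lookup_minus lookup_single when_def in_keys_iff)
    have sub: "Poly_Mapping.keys m' \<subseteq> Poly_Mapping.keys m"
      by (auto simp: m in_keys_iff lookup_add)
    have "(\<Sum>i\<in>Poly_Mapping.keys m. Poly_Mapping.lookup m i) =
        (\<Sum>j\<in>Poly_Mapping.keys m. Poly_Mapping.lookup m' j + (if j = i then 1 else 0))"
      by (intro sum.cong) (auto simp: m lookup_add lookup_single)
    also have "\<dots> = (\<Sum>j\<in>Poly_Mapping.keys m. Poly_Mapping.lookup m' j) + 1"
      using i by (simp add: sum.distrib)
    also have "(\<Sum>j\<in>Poly_Mapping.keys m. Poly_Mapping.lookup m' j) =
        (\<Sum>j\<in>Poly_Mapping.keys m'. Poly_Mapping.lookup m' j)"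
      using sub by (intro sum.mono_neutral_right) (auto simp: in_keys_iff)
    finally have "(\<Sum>j\<in>Poly_Mapping.keys m'. Poly_Mapping.lookup m' j) = N"
      using Suc.prems(1) by simp
    then have "Poly_Mapping.lookup (mp_deriv i g) m' = 0"
      using Suc.IH[of m' "mp_deriv i g"] mp_deriv_vanishes[OF Suc.prems(2)] by blast
    then show ?case
      unfolding lookup_mp_deriv m by (simp del: of_nat_Suc)
  qed
  then show "Poly_Mapping.lookup g m = Poly_Mapping.lookup 0 m" using assms by simp
qed

section \<open>Preservation of stability\<close>

theorem lemma6p1:
  fixes n d :: nat and \<kappa> :: "nat \<Rightarrow> nat" and \<theta> :: real
  assumes "n \<ge> 2"
    and "\<kappa> 1 = d" and "\<kappa> 2 = d"
    and "0 \<le> \<theta>" and "\<theta> < 2 * pi"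
  shows "preserves_stability n \<theta> (poly_space n \<kappa>) (T_op d)"
  unfolding preserves_stability_def
proof (intro ballI impI)
  fix f assume f: "f \<in> poly_space n \<kappa>" "stable n \<theta> f"
  show "stable n \<theta> (T_op d f) \<or> T_op d f = 0"
  proof (cases "stable n \<theta> (T_op d f)")
    case False
    then obtain p where "\<forall>i\<in>{1..n}. p i \<in> half_plane \<theta>" "mp_eval p (T_op d f) = 0"
      unfolding stable_def by blast
    then have "T_op d f = 0"
      using T_op_zero_everywhere[OF f(1) assms(1-3) f(2)] by (intro vanishing_imp_zero) blast
    then show ?thesis ..
  qed simp
qed

end
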